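(* Let $G$ be a simple undirected graph on vertices $\{1,\dots,n\}$ with adjacency matrix $A_G$. The polytope $P_G$ is quasi-integral; that is, the subgraph of the $1$-skeleton of $P_G$ induced by the integer points (the integer vertices) of $P_G$ is connected.
   Context: $P_G\subseteq\mathbb{R}^{n\times n}$ is the polytope of doubly stochastic matrices commuting with $A_G$: $$P_G=\Big\{P\in\mathbb{R}^{n\times n}: PA_G=A_GP,\ \sum_{i=1}^nP_{i,j}=1\ (1\le j\le n),\ \sum_{j=1}^nP_{i,j}=1\ (1\le i\le n),\ P_{i,j}\ge0\ (1\le i,j\le n)\Big\}.$$ The $1$-skeleton of a polytope is the graph whose vertices are the vertices of the polytope and whose edges are its one-dimensional faces. *)

theory Defs
  imports "HOL-Analysis.Analysis" "Graph_Theory.Graph_Theory"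
begin

definition adjacency_matrix :: "'n::finite pair_pre_digraph \<Rightarrow> real^'n^'n" where
  "adjacency_matrix G = (\<chi> i j. of_bool ((i, j) \<in> parcs G))"

definition commuting_ds_polytope :: "'n::finite pair_pre_digraph \<Rightarrow> (real^'n^'n) set" where
  "commuting_ds_polytope G =
     {P. P ** adjacency_matrix G = adjacency_matrix G ** P
       \<and> (\<forall>j. (\<Sum>i\<in>UNIV. P $ i $ j) = 1)
       \<and> (\<forall>i. (\<Sum>j\<in>UNIV. P $ i $ j) = 1)
       \<and> (\<forall>i j. 0 \<le> P $ i $ j)}"

(* A one-dimensional face of a polytope is a segment, and its endpoints are the
   two vertices that it joins (see edge_of_polytope_segment and
   pair_bidirected_digraph_skeleton below).  Each edge appears as a pair of
   opposite arcs. *)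
definition skeleton :: "'a::euclidean_space set \<Rightarrow> 'a pair_pre_digraph" where
  "skeleton S = \<lparr> pverts = {v. v extreme_point_of S},
                  parcs = {(u, v). closed_segment u v edge_of S} \<rparr>"

definition integer_matrices :: "(real^'n^'m) set" where
  "integer_matrices = {P. \<forall>i j. P $ i $ j \<in> \<int>}"

(* The name of the graph-theoretic predicate is qualified because HOL-Analysis has
   a topological predicate with the same base name. *)
definition quasi_integral :: "(real^'n^'m) set \<Rightarrow> bool" where
  "quasi_integral S \<longleftrightarrow>
     Digraph_Component.connected
       (with_proj (skeleton S) \<restriction> (pverts (skeleton S) \<inter> integer_matrices))"

lemma edge_of_polytope_segment:
  assumes "polytope S" "F edge_of S"
  obtains u v where "u \<noteq> v" "F = closed_segment u v"
proof -
  have F: "polytope F" "aff_dim F = 1"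
    using assms face_of_polytope_polytope by (auto simp: edge_of_def)
  then have "compact F" "convex F" "collinear F"
    by (auto simp: polytope_imp_compact polytope_imp_convex collinear_aff_dim)
  then obtain u v where uv: "F = closed_segment u v"
    using F(2) compact_convex_collinear_segment by (metis aff_dim_empty_eq neg_equal_iff_equal one_neq_neg_one)
  with F(2) have "u \<noteq> v" by auto
  with uv show thesis by (rule that[rotated])
qed

lemma pair_bidirected_digraph_skeleton: "pair_bidirected_digraph (skeleton S)"
proof -
  have ext: "u extreme_point_of S \<and> v extreme_point_of S"
    if "closed_segment u v edge_of S" for u v :: 'a
  proof -
    have f: "closed_segment u v face_of S" using that by (simp add: edge_of_def)
    have "u extreme_point_of closed_segment u v" "v extreme_point_of closed_segment u v"
      by (simp_all add: extreme_point_of_segment)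
    then show ?thesis
      using extreme_point_of_face[OF f] by blast
  qed
  have loop: "\<not> {u} edge_of S" for u :: 'a
    by (simp add: edge_of_def)
  show ?thesis
    by unfold_locales
       (auto simp: skeleton_def symmetric_def sym_def closed_segment_commute
         loop dest: ext)
qed

lemma polytope_commuting_ds_polytope: "polytope (commuting_ds_polytope G)"
proof -
  let ?A = "adjacency_matrix G"
  have "(u *\<^sub>R P + v *\<^sub>R Q) ** ?A = u *\<^sub>R (P ** ?A) + v *\<^sub>R (Q ** ?A)"
       "?A ** (u *\<^sub>R P + v *\<^sub>R Q) = u *\<^sub>R (?A ** P) + v *\<^sub>R (?A ** Q)"
    for u v and P Q :: "real^'a^'a"
    by (simp_all add: vec_eq_iff matrix_matrix_mult_def sum_distrib_left
          algebra_simps sum.distrib)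
  then have 1: "polyhedron {P. P ** ?A = ?A ** P}"
    by (intro affine_imp_polyhedron) (auto simp: affine_def)
  have 2: "polyhedron {P :: real^'a^'a. (\<Sum>i\<in>UNIV. P $ i $ j) = 1}" for j
    by (rule affine_imp_polyhedron)
       (auto simp: affine_def sum.distrib simp flip: sum_distrib_left)
  have 3: "polyhedron {P :: real^'a^'a. (\<Sum>j\<in>UNIV. P $ i $ j) = 1}" for i
    by (rule affine_imp_polyhedron)
       (auto simp: affine_def sum.distrib simp flip: sum_distrib_left)
  have 4: "polyhedron {P :: real^'a^'a. 0 \<le> P $ i $ j}" for i j
  proof -
    have "{P :: real^'a^'a. 0 \<le> P $ i $ j} = {P. axis i (axis j 1) \<bullet> P \<ge> 0}"
      by (auto simp: inner_axis inner_axis')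
    then show ?thesis by (simp add: polyhedron_halfspace_ge)
  qed
  have eq: "commuting_ds_polytope G = {P. P ** ?A = ?A ** P}
     \<inter> \<Inter>(range (\<lambda>j. {P. (\<Sum>i\<in>UNIV. P $ i $ j) = 1}))
     \<inter> \<Inter>(range (\<lambda>i. {P. (\<Sum>j\<in>UNIV. P $ i $ j) = 1}))
     \<inter> \<Inter>(range (\<lambda>(i, j). {P. 0 \<le> P $ i $ j}))"
    by (auto simp: commuting_ds_polytope_def)
  have "polyhedron (commuting_ds_polytope G)"
    unfolding eq by (intro polyhedron_Int polyhedron_Inter) (use 1 2 3 4 in auto)
  moreover have "bounded (commuting_ds_polytope G)"
  proof (rule boundedI)
    fix P assume P: "P \<in> commuting_ds_polytope G"
    have "norm P \<le> (\<Sum>i\<in>UNIV. norm (P $ i))" 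
      unfolding norm_vec_def by (rule L2_set_le_sum) simp
    also have "\<dots> \<le> (\<Sum>i\<in>UNIV. \<Sum>j\<in>UNIV. \<bar>P $ i $ j\<bar>)"
      by (intro sum_mono norm_le_l1_cart)
    also have "\<dots> = (\<Sum>i\<in>(UNIV :: 'a set). 1)"
      using P by (intro sum.cong) (auto simp: commuting_ds_polytope_def)
    finally show "norm P \<le> (\<Sum>i\<in>(UNIV :: 'a set). 1)" .
  qed
  ultimately show ?thesis by (simp add: polytope_eq_bounded_polyhedron)
qed

(* Thus the intersection with the vertex set in quasi_integral removes no integer
   point of the polytope. *)
lemma integer_point_extreme:
  assumes "P \<in> commuting_ds_polytope G" "P \<in> integer_matrices"
  shows "P extreme_point_of commuting_ds_polytope G"
proof -
  have bnd: "0 \<le> Q $ i $ j \<and> Q $ i $ j \<le> 1" if "Q \<in> commuting_ds_polytope G" for Q i j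
  proof -
    have "Q $ i $ j \<le> (\<Sum>j\<in>UNIV. Q $ i $ j)"
      using that by (intro member_le_sum) (auto simp: commuting_ds_polytope_def)
    with that show ?thesis by (auto simp: commuting_ds_polytope_def)
  qed
  have P01: "P $ i $ j = 0 \<or> P $ i $ j = 1" for i j
  proof -
    obtain k where k: "P $ i $ j = of_int k"
      using assms(2) unfolding integer_matrices_def by (auto simp: Ints_def)
    show ?thesis using bnd[OF assms(1), of i j] unfolding k by (cases "k = 0") auto
  qed
  have False
    if A: "A \<in> commuting_ds_polytope G" and B: "B \<in> commuting_ds_polytope G"
      and seg: "P \<in> open_segment A B" for A B
  proof -
    from seg obtain u where u: "A \<noteq> B" "0 < u" "u < 1" "P = (1 - u) *\<^sub>R A + u *\<^sub>R B"
      by (auto simp: in_segment)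
    have "A $ i $ j = B $ i $ j" for i j
    proof -
      have p: "P $ i $ j = (1 - u) * A $ i $ j + u * B $ i $ j" using u(4) by simp
      from P01[of i j] show ?thesis
      proof
        assume "P $ i $ j = 0"
        moreover have "0 \<le> (1 - u) * A $ i $ j" "0 \<le> u * B $ i $ j"
          using u bnd[OF A, of i j] bnd[OF B, of i j] by auto
        ultimately have "(1 - u) * A $ i $ j = 0" "u * B $ i $ j = 0" using p by linarith+
        then show ?thesis using u by simp
      next
        assume "P $ i $ j = 1"
        moreover have "0 \<le> (1 - u) * (1 - A $ i $ j)" "0 \<le> u * (1 - B $ i $ j)"
          using u bnd[OF A, of i j] bnd[OF B, of i j] by auto
        moreover have "(1 - u) * (1 - A $ i $ j) + u * (1 - B $ i $ j) = 1 - P $ i $ j"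
          unfolding p by (simp add: algebra_simps)
        ultimately have "(1 - u) * (1 - A $ i $ j) = 0" "u * (1 - B $ i $ j) = 0" by linarith+
        then show ?thesis using u by simp
      qed
    qed
    then have "A = B" by (simp add: vec_eq_iff)
    with u(1) show False by simp
  qed
  then show ?thesis using assms(1) by (auto simp: extreme_point_of_def)
qed

end

theory Submission
  imports Defs
begin

text \<open>
  The integer points are the permutation matrices of automorphisms. A point of the minimal
  face containing two of them, \<open>P\<close> and \<open>Q\<close>, mixes their rows with weights
  \<open>t i\<close>, and whether such a mix lies in the polytope only depends on which weights
  coincide. So if the face is larger than the segment from \<open>P\<close> to \<open>Q\<close>, rounding the
  weights to the indicator of a level set of \<open>t\<close> gives a third integer point, which
  differs from each of \<open>P\<close> and \<open>Q\<close> in fewer rows than these differ from one another.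
\<close>

definition permutation_matrix :: "('n::finite \<Rightarrow> 'n) \<Rightarrow> real^'n^'n" where
  "permutation_matrix p = (\<chi> i j. of_bool (p i = j))"

text \<open>The weight may change from row to row. Constant weights in [0, 1] give the points of the
  segment from \<open>P\<close> to \<open>Q\<close>; weight 0 selects the row of \<open>P\<close>
  and weight 1 that of \<open>Q\<close>.\<close>

definition row_mix :: "('m \<Rightarrow> real) \<Rightarrow> real^'n^'m \<Rightarrow> real^'n^'m \<Rightarrow> real^'n^'m" where
  "row_mix t P Q = (\<chi> i j. (1 - t i) * P $ i $ j + t i * Q $ i $ j)"

lemma sum_of_bool_bij:
  fixes f :: "'n::finite \<Rightarrow> real"
  assumes "bij p"
  shows "(\<Sum>k\<in>UNIV. f k * of_bool (p k = j)) = f (inv p j)"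
proof -
  have "(p k = j) = (k = inv p j)" for k
    using assms by (metis bij_inv_eq_iff)
  then show ?thesis by (simp add: of_bool_def sum.delta if_distrib cong: if_cong)
qed

lemma permutation_matrix_mult_left:
  "(permutation_matrix p ** A) $ i $ j = A $ p i $ j"
  by (simp add: permutation_matrix_def matrix_matrix_mult_def of_bool_def if_distribR
      if_distrib[of "\<lambda>x. x * _"] cong: if_cong)

lemma permutation_matrix_mult_right:
  assumes "bij p"
  shows "(A ** permutation_matrix p) $ i $ j = A $ i $ inv p j"
  using sum_of_bool_bij[OF assms, of "\<lambda>k. A $ i $ k"]
  by (simp add: permutation_matrix_def matrix_matrix_mult_def)

text \<open>Nonnegative integer entries with row sums 1 are 0 or 1, with exactly one 1 per row, in
  column \<open>p i\<close>. Each column contains a 1 as well, so \<open>p\<close> is surjective and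
  hence bijective on the finite index type.\<close>

lemma integer_point_cases:
  assumes "P \<in> commuting_ds_polytope G" "P \<in> integer_matrices"
  obtains p where "bij p" "P = permutation_matrix p"
proof -
  have rows: "(\<Sum>j\<in>UNIV. P $ i $ j) = 1" and cols: "(\<Sum>i\<in>UNIV. P $ i $ j) = 1"
    and nonneg: "0 \<le> P $ i $ j" for i j
    using assms(1) by (auto simp: commuting_ds_polytope_def)
  have P01: "P $ i $ j = 0 \<or> P $ i $ j = 1" for i j
  proof -
    obtain k where k: "P $ i $ j = of_int k"
      using assms(2) unfolding integer_matrices_def by (auto simp: Ints_def)
    have "P $ i $ j \<le> (\<Sum>j\<in>UNIV. P $ i $ j)"
      using nonneg by (intro member_le_sum) auto
    with nonneg[of i j] show ?thesis unfolding rows k by (cases "k = 0") auto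
  qed
  have "\<exists>j. P $ i $ j = 1" for i
    using rows[of i] P01[of i] by (metis (no_types, lifting) sum.neutral zero_neq_one)
  then obtain p where p: "P $ i $ p i = 1" for i by metis
  have unique: "p i = j" if "P $ i $ j = 1" for i j
  proof (rule ccontr)
    assume "p i \<noteq> j"
    then have "P $ i $ p i + P $ i $ j = (\<Sum>k\<in>{p i, j}. P $ i $ k)" by simp
    also have "\<dots> \<le> (\<Sum>k\<in>UNIV. P $ i $ k)" using nonneg by (intro sum_mono2) auto
    finally show False using rows[of i] that p[of i] by simp
  qed
  have "\<exists>i. P $ i $ j = 1" for j
    using cols[of j] P01[of _ j] by (metis (no_types, lifting) sum.neutral zero_neq_one)
  then have "surj p" using unique by (metis surj_def)
  then have "bij p" by (simp add: finite_UNIV_surj_inj bij_def)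
  moreover have "P = permutation_matrix p"
    using P01 p unique by (auto simp: vec_eq_iff permutation_matrix_def of_bool_def) metis
  ultimately show thesis by (rule that)
qed

text \<open>The first condition comes from the column sums: column \<open>j\<close> receives its
  weights from rows \<open>inv p j\<close> and \<open>inv q j\<close>. The second comes entrywise
  from commutation. Both involve only equalities between values of \<open>t\<close>, so they survive
  any change of weights that preserves these equalities.\<close>

lemma row_mix_mem_iff:
  fixes G :: "'n::finite pair_pre_digraph"
  defines "A \<equiv> adjacency_matrix G"
  assumes P: "permutation_matrix p \<in> commuting_ds_polytope G" and p: "bij p"
    and Q: "permutation_matrix q \<in> commuting_ds_polytope G" and q: "bij q"
    and t: "\<And>i. 0 \<le> t i" "\<And>i. t i \<le> 1"
  shows "row_mix t (permutation_matrix p) (permutation_matrix q) \<in> commuting_ds_polytope G \<longleftrightarrow>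
    (\<forall>j. t (inv q j) = t (inv p j)) \<and>
    (\<forall>i j. t i = t (inv p j) \<or> A $ p i $ j = A $ q i $ j)"
    (is "?X \<in> _ \<longleftrightarrow> _")
proof -
  \<comment> \<open>Commutation of each permutation matrix with \<open>A\<close> lets both products
    of the mix with \<open>A\<close> be written in the same two entries \<open>A $ p i $ j\<close>
    and \<open>A $ q i $ j\<close>.\<close>
  have Ap: "A $ i $ inv p j = A $ p i $ j" and Aq: "A $ i $ inv q j = A $ q i $ j" for i j
    using P Q permutation_matrix_mult_left[of p A i j] permutation_matrix_mult_right[OF p, of A i j]
      permutation_matrix_mult_left[of q A i j] permutation_matrix_mult_right[OF q, of A i j]
    by (simp_all add: commuting_ds_polytope_def A_def)
  have X: "?X $ i $ j = (1 - t i) * of_bool (p i = j) + t i * of_bool (q i = j)" for i j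
    by (simp add: row_mix_def permutation_matrix_def)
  have left: "(?X ** A) $ i $ j = (1 - t i) * A $ p i $ j + t i * A $ q i $ j" for i j
  proof -
    have "(?X ** A) $ i $ j = (1 - t i) * (permutation_matrix p ** A) $ i $ j
        + t i * (permutation_matrix q ** A) $ i $ j"
      by (simp add: row_mix_def matrix_matrix_mult_def sum_distrib_left distrib_right mult.assoc
          flip: sum.distrib)
    then show ?thesis by (simp add: permutation_matrix_mult_left)
  qed
  have right: "(A ** ?X) $ i $ j = (1 - t (inv p j)) * A $ p i $ j + t (inv q j) * A $ q i $ j" for i j
  proof -
    have "(A ** ?X) $ i $ j = (\<Sum>k\<in>UNIV. (A $ i $ k * (1 - t k)) * of_bool (p k = j))
        + (\<Sum>k\<in>UNIV. (A $ i $ k * t k) * of_bool (q k = j))"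
      by (simp only: matrix_matrix_mult_def X vec_lambda_beta sum.distrib[symmetric])
        (simp add: algebra_simps)
    then show ?thesis
      by (simp only: sum_of_bool_bij[OF p] sum_of_bool_bij[OF q] Ap Aq mult.commute[of "A $ _ $ _"])
  qed
  have row: "(\<Sum>j\<in>UNIV. ?X $ i $ j) = 1" for i
    by (simp add: X sum.distrib flip: sum_distrib_left)
  have col: "(\<Sum>i\<in>UNIV. ?X $ i $ j) = 1 - t (inv p j) + t (inv q j)" for j
    by (simp only: X sum.distrib sum_of_bool_bij[OF p] sum_of_bool_bij[OF q])
  have nonneg: "0 \<le> ?X $ i $ j" for i j
    using t by (simp add: X)
  have factor: "((1 - x) * a + x * b = (1 - y) * a + y * b) = (x = y \<or> a = b)" for x y a b :: real
  proof -
    have "((1 - x) * a + x * b = (1 - y) * a + y * b) = ((x - y) * (a - b) = 0)"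
      by (simp add: algebra_simps) linarith
    then show ?thesis by simp
  qed
  have "?X \<in> commuting_ds_polytope G \<longleftrightarrow> (\<forall>j. t (inv q j) = t (inv p j)) \<and>
    (\<forall>i j. (1 - t i) * A $ p i $ j + t i * A $ q i $ j
      = (1 - t (inv p j)) * A $ p i $ j + t (inv q j) * A $ q i $ j)"
    using row col nonneg
    by (simp add: commuting_ds_polytope_def A_def[symmetric] vec_eq_iff[of "_ ** _"]
        vec_eq_iff[of "(_ ** _) $ _"] left right conj_commute)
  \<comment> \<open>Given the first conjunct, both sides mix the same two numbers, with weights
    \<open>t i\<close> and \<open>t (inv p j)\<close>; they agree iff the weights or the numbers
    do.\<close>
  also have "\<dots> \<longleftrightarrow> (\<forall>j. t (inv q j) = t (inv p j)) \<and>
    (\<forall>i j. t i = t (inv p j) \<or> A $ p i $ j = A $ q i $ j)"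
    by (rule conj_cong[OF refl]) (simp add: factor)
  finally show ?thesis .
qed

text \<open>The points that vanish wherever \<open>P\<close> and \<open>Q\<close> both vanish form
  the smallest face containing \<open>P\<close> and \<open>Q\<close>. Nonnegativity is what makes
  this set a face: a proper mix of two points of the polytope has a zero entry only if both points
  do.\<close>

lemma closed_segment_face_of:
  assumes P: "P \<in> commuting_ds_polytope G" and Q: "Q \<in> commuting_ds_polytope G"
    and only: "\<And>X. X \<in> commuting_ds_polytope G \<Longrightarrow>
      (\<And>i j. P $ i $ j = 0 \<Longrightarrow> Q $ i $ j = 0 \<Longrightarrow> X $ i $ j = 0) \<Longrightarrow> X \<in> closed_segment P Q"
  shows "closed_segment P Q face_of commuting_ds_polytope G"
proof -
  let ?S = "commuting_ds_polytope G"
  have "convex ?S" by (simp add: polytope_commuting_ds_polytope polytope_imp_convex)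
  then have sub: "closed_segment P Q \<subseteq> ?S" using P Q by (simp add: closed_segment_subset)
  have ends: "Y \<in> closed_segment P Q \<and> Z \<in> closed_segment P Q"
    if Y: "Y \<in> ?S" and Z: "Z \<in> ?S" and X: "X \<in> closed_segment P Q" "X \<in> open_segment Y Z" for X Y Z
  proof -
    obtain u where u: "0 < u" "u < 1" "X = (1 - u) *\<^sub>R Y + u *\<^sub>R Z"
      using X(2) by (auto simp: in_segment)
    obtain v where v: "X = (1 - v) *\<^sub>R P + v *\<^sub>R Q"
      using X(1) by (auto simp: in_segment)
    have "Y $ i $ j = 0 \<and> Z $ i $ j = 0" if "P $ i $ j = 0" "Q $ i $ j = 0" for i j
    proof -
      have "(1 - u) * Y $ i $ j + u * Z $ i $ j = X $ i $ j" using u(3) by simp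
      also have "\<dots> = 0" using v that by simp
      finally have "(1 - u) * Y $ i $ j + u * Z $ i $ j = 0" .
      moreover have "0 \<le> (1 - u) * Y $ i $ j" "0 \<le> u * Z $ i $ j"
        using u Y Z by (auto simp: commuting_ds_polytope_def)
      ultimately have "(1 - u) * Y $ i $ j = 0" "u * Z $ i $ j = 0" by linarith+
      then show ?thesis using u by simp
    qed
    then show ?thesis using only[OF Y] only[OF Z] by simp
  qed
  show ?thesis
    unfolding face_of_def using sub convex_closed_segment ends by blast
qed

text \<open>Taking every row from \<open>P\<close> or \<open>Q\<close> makes \<open>R\<close> agree
  with both wherever they agree with each other, which is what lets an induction on the number of
  differing rows proceed.\<close>

lemma edge_or_intermediate:
  assumes P: "P \<in> commuting_ds_polytope G" "P \<in> integer_matrices"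
    and Q: "Q \<in> commuting_ds_polytope G" "Q \<in> integer_matrices"
    and "P \<noteq> Q" and no_edge: "\<not> closed_segment P Q edge_of commuting_ds_polytope G"
  obtains R where "R \<in> commuting_ds_polytope G" "R \<in> integer_matrices" "R \<noteq> P" "R \<noteq> Q"
    "\<And>i. R $ i = P $ i \<or> R $ i = Q $ i"
proof -
  obtain p where p: "bij p" "P = permutation_matrix p" using integer_point_cases P by metis
  obtain q where q: "bij q" "Q = permutation_matrix q" using integer_point_cases Q by metis
  have "aff_dim (closed_segment P Q) = 1"
    using \<open>P \<noteq> Q\<close> by (simp add: segment_convex_hull aff_dim_convex_hull aff_dim_2)
  then have "\<not> closed_segment P Q face_of commuting_ds_polytope G"
    using no_edge by (simp add: edge_of_def)
  then obtain X where X: "X \<in> commuting_ds_polytope G" "X \<notin> closed_segment P Q"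
    and "\<And>i j. P $ i $ j = 0 \<Longrightarrow> Q $ i $ j = 0 \<Longrightarrow> X $ i $ j = 0"
    using closed_segment_face_of[OF P(1) Q(1)] by blast
  then have supp: "X $ i $ j = 0" if "j \<noteq> p i" "j \<noteq> q i" for i j
    using that by (auto simp: p q permutation_matrix_def)
  have rows: "(\<Sum>j\<in>UNIV. X $ i $ j) = 1" and nonneg: "0 \<le> X $ i $ j" for i j
    using X(1) by (auto simp: commuting_ds_polytope_def)
  \<comment> \<open>Row \<open>i\<close> of \<open>X\<close> is supported on columns
    \<open>p i\<close> and \<open>q i\<close>, so its entry at \<open>q i\<close> is the weight of
    \<open>Q\<close>. If \<open>p i = q i\<close> this yields weight 1, but there the mixed row is
    the same for every weight.\<close>
  define t where "t i = X $ i $ q i" for i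
  have row: "(\<Sum>j\<in>{p i, q i}. X $ i $ j) = 1" for i
    using rows[of i] supp by (subst sum.mono_neutral_left[of UNIV]) auto
  have t: "0 \<le> t i" "t i \<le> 1" for i
  proof -
    show "0 \<le> t i" by (simp add: t_def nonneg)
    have "t i \<le> (\<Sum>j\<in>{p i, q i}. X $ i $ j)"
      unfolding t_def by (rule member_le_sum) (use nonneg in auto)
    then show "t i \<le> 1" by (simp add: row)
  qed
  have "X $ i $ j = row_mix t P Q $ i $ j" for i j
    using row[of i] supp[of j i]
    by (cases "p i = q i"; cases "j = p i"; cases "j = q i")
      (auto simp: row_mix_def p q permutation_matrix_def t_def)
  then have X_eq: "X = row_mix t P Q" by (simp add: vec_eq_iff)
  obtain a where a: "p a \<noteq> q a"
    using \<open>P \<noteq> Q\<close> p q by (metis ext)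
  \<comment> \<open>Were \<open>t\<close> constant on the rows where \<open>P\<close> and
    \<open>Q\<close> differ, \<open>X\<close> would lie on the segment between them.\<close>
  obtain b where b: "p b \<noteq> q b" "t b \<noteq> t a"
  proof (rule ccontr)
    assume "\<not> thesis"
    with that have const: "p i = q i \<or> t i = t a" for i by blast
    have "X $ i $ j = ((1 - t a) *\<^sub>R P + t a *\<^sub>R Q) $ i $ j" for i j
      using const[of i] by (auto simp: X_eq row_mix_def p q permutation_matrix_def algebra_simps)
    then have "X = (1 - t a) *\<^sub>R P + t a *\<^sub>R Q" by (simp add: vec_eq_iff)
    then show False using X(2) t[of a] by (auto simp: in_segment)
  qed
  \<comment> \<open>Equal values of \<open>t\<close> give equal values of \<open>s\<close>, so the
    membership conditions pass from \<open>t\<close> to \<open>s\<close>; values 0 and 1 make the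
    mix integral.\<close>
  define s :: "_ \<Rightarrow> real" where "s i = of_bool (t i = t a)" for i
  define R where "R = row_mix s P Q"
  have R_row: "R $ i = (if t i = t a then Q $ i else P $ i)" for i
    by (simp add: R_def row_mix_def s_def vec_eq_iff)
  note mem_iff = row_mix_mem_iff[OF P(1)[unfolded p] p(1) Q(1)[unfolded q] q(1)]
  have "R \<in> commuting_ds_polytope G"
    using X(1) t unfolding R_def X_eq p(2) q(2)
    by (subst (asm) mem_iff, simp, simp, subst mem_iff) (auto simp: s_def, metis+)
  moreover have "R \<in> integer_matrices"
    using P(2) Q(2) by (simp add: integer_matrices_def R_row)
  \<comment> \<open>Row \<open>a\<close> of \<open>R\<close> is taken from \<open>Q\<close> and row
    \<open>b\<close> from \<open>P\<close>, and \<open>P\<close> and \<open>Q\<close> differ in both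
    rows.\<close>
  moreover have "R $ a $ q a \<noteq> P $ a $ q a" "R $ b $ p b \<noteq> Q $ b $ p b"
    using a b by (simp_all add: R_row p q permutation_matrix_def)
  then have "R \<noteq> P" "R \<noteq> Q" by auto
  ultimately show thesis using that R_row by metis
qed

theorem proposition4p1:
  fixes G :: "'n::finite pair_pre_digraph"
  assumes "pair_graph G" and "pverts G = UNIV"
  shows "quasi_integral (commuting_ds_polytope G)"
proof -
  let ?S = "commuting_ds_polytope G"
  let ?V = "pverts (skeleton ?S) \<inter> integer_matrices"
  let ?K = "with_proj (skeleton ?S) \<restriction> ?V"
  let ?H = "mk_symmetric ?K"
  have V: "?V = ?S \<inter> integer_matrices"
    using integer_point_extreme by (auto simp: skeleton_def extreme_point_of_def)
  interpret skel: pair_bidirected_digraph "skeleton ?S"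
    by (rule pair_bidirected_digraph_skeleton)
  interpret K: wf_digraph ?K
    by (rule skel.wellformed_induce_subgraph)
  interpret H: pair_wf_digraph ?H ..
  have reach: "P \<rightarrow>\<^sup>*\<^bsub>?H\<^esub> Q" if "P \<in> ?V" "Q \<in> ?V" for P Q
    using that
  proof (induction "card {i. P $ i \<noteq> Q $ i}" arbitrary: P Q rule: less_induct)
    case less
    consider "P = Q" | "P \<noteq> Q" "closed_segment P Q edge_of ?S"
      | "P \<noteq> Q" "\<not> closed_segment P Q edge_of ?S" by blast
    then show ?case
    proof cases
      case 1
      with less.prems show ?thesis by auto
    next
      case 2
      then have "(P, Q) \<in> parcs (skeleton ?S)" by (simp add: skeleton_def)
      then have "(P, Q) \<in> parcs ?H"
        using less.prems by (auto simp: parcs_mk_symmetric)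
      then show ?thesis by auto
    next
      case 3
      then obtain R where R: "R \<in> ?S" "R \<in> integer_matrices" "R \<noteq> P" "R \<noteq> Q"
        "\<And>i. R $ i = P $ i \<or> R $ i = Q $ i"
        using edge_or_intermediate less.prems V by (metis IntE)
      \<comment> \<open>Each inclusion is strict because \<open>R\<close> differs from the other
        endpoint: a row where \<open>R\<close> and \<open>Q\<close> differ is a row of
        \<open>P\<close>, hence lies in the larger set but not in the first smaller one;
        symmetrically for the second.\<close>
      have "{i. P $ i \<noteq> R $ i} \<subset> {i. P $ i \<noteq> Q $ i}" "{i. R $ i \<noteq> Q $ i} \<subset> {i. P $ i \<noteq> Q $ i}"
        using R(3-5) by (auto simp: vec_eq_iff psubset_eq set_eq_iff) metis+
      then have "card {i. P $ i \<noteq> R $ i} < card {i. P $ i \<noteq> Q $ i}"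
        "card {i. R $ i \<noteq> Q $ i} < card {i. P $ i \<noteq> Q $ i}"
        by (simp_all add: psubset_card_mono)
      moreover have "R \<in> ?V" using R V by blast
      ultimately show ?thesis
        using less.hyps less.prems H.reachable_trans by blast
    qed
  qed
  \<comment> \<open>Connectedness includes having a vertex; the identity matrix is an integer point
    for every graph.\<close>
  have "mat 1 \<in> ?V"
    unfolding V by (auto simp: commuting_ds_polytope_def integer_matrices_def mat_def
        matrix_mul_lid[unfolded mat_def] matrix_mul_rid[unfolded mat_def])
  then have "verts ?H \<noteq> {}" by auto
  then show ?thesis
    using reach by (simp add: quasi_integral_def Digraph_Component.connected_def strongly_connected_def)
qed

end
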